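(* Let $p$ be a prime and $n\ge 1$ an integer. The simplicial complexes $X(\mathbb{F}_p^n)$ and $K(\mathbb{F}_p^n)$ are matroids.
   Context: $X(\mathbb{F}_p^n)$ is the simplicial complex whose vertices are the nonzero vectors of $\mathbb{F}_p^n$ and whose simplices are the linearly independent subsets of $\mathbb{F}_p^n$. $K(\mathbb{F}_p^n)$ is the simplicial complex whose vertices are the $1$-dimensional subspaces (lines) of $\mathbb{F}_p^n$ and whose simplices are the sets of lines $\{l_1,\dots,l_k\}$ spanning a $k$-dimensional subspace. A finite simplicial complex $M$ is called a matroid if for any two simplices $\sigma,\tau\in M$ such that $\sigma$ has more elements than $\tau$, there is $v\in\sigma\setminus\tau$ such that $\tau\cup\{v\}\in M$. *)

theory Defs
  imports "HOL-Analysis.Cartesian_Space" "Berlekamp_Zassenhaus.Finite_Field"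
begin

text \<open>
  A simplicial complex is given by its vertex set together with its set of simplices; the
  empty set counts as a simplex. Every vertex spans a simplex, so there are no ghost vertices.
\<close>

record 'v scomplex =
  vertices :: "'v set"
  simplices :: "'v set set"

definition finite_simplicial_complex :: "'v scomplex \<Rightarrow> bool" where
  "finite_simplicial_complex M \<longleftrightarrow>
     finite (vertices M) \<and>
     simplices M \<subseteq> Pow (vertices M) \<and>
     {} \<in> simplices M \<and>
     (\<forall>v\<in>vertices M. {v} \<in> simplices M) \<and>
     (\<forall>\<sigma>\<in>simplices M. \<forall>\<tau>. \<tau> \<subseteq> \<sigma> \<longrightarrow> \<tau> \<in> simplices M)"

definition matroid :: "'v scomplex \<Rightarrow> bool" where
  "matroid M \<longleftrightarrow>
     finite_simplicial_complex M \<and>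
     (\<forall>\<sigma>\<in>simplices M. \<forall>\<tau>\<in>simplices M. card \<tau> < card \<sigma> \<longrightarrow>
        (\<exists>v\<in>\<sigma> - \<tau>. \<tau> \<union> {v} \<in> simplices M))"

definition X_complex :: "('a::field ^ 'n::finite) scomplex" where
  "X_complex = \<lparr> vertices = {v. v \<noteq> 0}, simplices = {S. vec.independent S} \<rparr>"

definition lines :: "('a::field ^ 'n::finite) set set" where
  "lines = {l. vec.subspace l \<and> vec.dim l = 1}"

text \<open>The subspace spanned by a set of lines is the span of their union.\<close>

definition K_complex :: "('a::field ^ 'n::finite) set scomplex" where
  "K_complex =
     \<lparr> vertices = lines,
       simplices = {L. finite L \<and> L \<subseteq> lines \<and> vec.dim (vec.span (\<Union>L)) = card L} \<rparr>"

end

theory Submission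
  imports Defs
begin

text \<open>
  Steinitz exchange gives the claim for \<open>X\<close>. Choosing a generator \<open>g l\<close> on each line \<open>l\<close>, a set of
  lines is a simplex of \<open>K\<close> iff its image under the injective map \<open>g\<close> is a simplex of \<open>X\<close>, so the
  matroid axioms for \<open>K\<close> are pulled back from those for \<open>X\<close>.
\<close>

text \<open>Injectivity of \<open>g\<close> makes it preserve cardinalities, so the exchange axiom
  of \<open>M\<close> applies to the images of two simplices of \<open>N\<close>; it also makes
  \<open>vertices N\<close> finite.\<close>

lemma matroid_inv_image:
  fixes M :: "'v scomplex" and N :: "'w scomplex"
  assumes M: "matroid M"
    and g: "inj_on g (vertices N)" "g ` vertices N \<subseteq> vertices M"
    and N: "simplices N = {L. L \<subseteq> vertices N \<and> g ` L \<in> simplices M}"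
  shows "matroid N"
proof -
  have fin: "finite (vertices M)"
    and emp: "{} \<in> simplices M"
    and vert: "\<And>v. v \<in> vertices M \<Longrightarrow> {v} \<in> simplices M"
    and down: "\<And>\<sigma> \<tau>. \<sigma> \<in> simplices M \<Longrightarrow> \<tau> \<subseteq> \<sigma> \<Longrightarrow> \<tau> \<in> simplices M"
    and exch: "\<And>\<sigma> \<tau>. \<lbrakk>\<sigma> \<in> simplices M; \<tau> \<in> simplices M; card \<tau> < card \<sigma>\<rbrakk>
                 \<Longrightarrow> \<exists>v\<in>\<sigma> - \<tau>. \<tau> \<union> {v} \<in> simplices M"
    using M unfolding matroid_def finite_simplicial_complex_def by blast+
  have "finite (vertices N)"
    using g fin by (meson finite_subset finite_imageD)
  moreover have "\<tau> \<in> simplices N" if "\<sigma> \<in> simplices N" "\<tau> \<subseteq> \<sigma>" for \<sigma> \<tau>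
    using that down[of "g ` \<sigma>" "g ` \<tau>"] unfolding N by blast
  moreover have "simplices N \<subseteq> Pow (vertices N)" "{} \<in> simplices N"
    using emp unfolding N by auto
  moreover have "{v} \<in> simplices N" if "v \<in> vertices N" for v
    using that vert g(2) unfolding N by auto
  ultimately have "finite_simplicial_complex N"
    unfolding finite_simplicial_complex_def by blast
  moreover have "\<exists>v\<in>\<sigma> - \<tau>. \<tau> \<union> {v} \<in> simplices N"
    if \<sigma>\<tau>: "\<sigma> \<in> simplices N" "\<tau> \<in> simplices N" "card \<tau> < card \<sigma>" for \<sigma> \<tau>
  proof -
    have "card (g ` \<sigma>) = card \<sigma>" "card (g ` \<tau>) = card \<tau>"
      using \<sigma>\<tau> inj_on_subset[OF g(1)] unfolding N by (auto intro!: card_image)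
    \<comment> \<open>The exchanged vertex lies in the image of \<sigma>, hence has the form
      \<open>g v\<close>. As it is not in the image of \<tau>, its preimage \<open>v\<close> is not
      in \<tau>.\<close>
    then obtain v where "v \<in> \<sigma>" "g v \<notin> g ` \<tau>" "g ` \<tau> \<union> {g v} \<in> simplices M"
      using exch[of "g ` \<sigma>" "g ` \<tau>"] \<sigma>\<tau> unfolding N by auto
    then show ?thesis
      using \<sigma>\<tau> unfolding N by (intro bexI[of _ v]) auto
  qed
  ultimately show ?thesis
    unfolding matroid_def by blast
qed

lemma matroid_X_complex:
  "matroid (X_complex :: ('a::{field,finite} ^ 'n::finite) scomplex)"
proof -
  have "\<exists>v\<in>\<sigma> - \<tau>. vec.independent (\<tau> \<union> {v})"
    if ind: "vec.independent \<sigma>" "vec.independent \<tau>" and lt: "card \<tau> < card \<sigma>"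
    for \<sigma> \<tau> :: "('a ^ 'n) set"
  proof -
    \<comment> \<open>Steinitz: an independent set inside the span of \<tau> has at most
      \<open>card \<tau>\<close> elements. A vector of \<sigma> outside this span can be added to
      \<tau>.\<close>
    have "\<not> \<sigma> \<subseteq> vec.span \<tau>"
    proof
      assume "\<sigma> \<subseteq> vec.span \<tau>"
      then have "card \<sigma> \<le> card \<tau>"
        using ind(1) vec.independent_span_bound[of \<tau> \<sigma>] by simp
      with lt show False by simp
    qed
    then obtain v where v: "v \<in> \<sigma>" "v \<notin> vec.span \<tau>"
      by blast
    then have "v \<notin> \<tau>" "vec.independent (insert v \<tau>)"
      using ind(2) vec.span_base by (auto simp: vec.independent_insert)
    with v show ?thesis by auto
  qed
  then show ?thesis
    unfolding matroid_def finite_simplicial_complex_def X_complex_def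
    \<comment> \<open>A set containing 0 is dependent, so independent sets consist of
      vertices.\<close>
    by (auto simp: vec.dependent_zero vec.independent_empty dest: vec.dependent_mono)
qed

definition generator :: "('a::field ^ 'n::finite) set \<Rightarrow> 'a ^ 'n" where
  "generator l = (SOME v. v \<noteq> 0 \<and> l = vec.span {v})"

text \<open>A basis of a line is a singleton, and its element witnesses the choice.\<close>

lemma generator:
  assumes "l \<in> lines"
  shows generator_nonzero: "generator l \<noteq> 0"
    and span_generator: "vec.span {generator l} = l"
proof -
  have l: "vec.subspace l" "vec.dim l = 1"
    using assms by (auto simp: lines_def)
  obtain B where B: "B \<subseteq> l" "vec.independent B" "l \<subseteq> vec.span B" "card B = vec.dim l"
    using vec.basis_exists by metis
  then obtain v where v: "B = {v}"
    using l(2) by (metis card_1_singletonE)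
  have "vec.span B = l"
    using B l(1) vec.span_minimal by blast
  moreover have "v \<noteq> 0"
    using B(2) v vec.dependent_zero[of B] by auto
  ultimately have "\<exists>v. v \<noteq> 0 \<and> l = vec.span {v}"
    unfolding v by (intro exI[of _ v]) (rule conjI, assumption, rule sym)
  then have *: "generator l \<noteq> 0 \<and> l = vec.span {generator l}"
    unfolding generator_def by (rule someI_ex)
  then show "generator l \<noteq> 0" ..
  from * show "vec.span {generator l} = l"
    by (elim conjE) (rule sym)
qed

lemma inj_on_generator: "inj_on generator lines"
  by (metis inj_onI span_generator)

lemma span_Union_lines:
  assumes "L \<subseteq> lines"
  shows "vec.span (\<Union>L) = vec.span (generator ` L)"
proof (rule vec.span_eq[THEN iffD2], intro conjI)
  show "\<Union>L \<subseteq> vec.span (generator ` L)"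
  proof
    fix x assume "x \<in> \<Union>L"
    then obtain l where l: "l \<in> L" "x \<in> vec.span {generator l}"
      using assms span_generator by blast
    moreover have "vec.span {generator l} \<subseteq> vec.span (generator ` L)"
      using l(1) by (intro vec.span_mono) auto
    ultimately show "x \<in> vec.span (generator ` L)" by blast
  qed
  have "generator l \<in> l" if "l \<in> L" for l
    using that assms span_generator[of l] vec.span_base[of "generator l" "{generator l}"] by auto
  then show "generator ` L \<subseteq> vec.span (\<Union>L)"
    by (auto intro: vec.span_base)
qed

text \<open>The generators number \<open>card L\<close> and have the same span as the lines, so the
  dimension is \<open>card L\<close> exactly when this spanning set is a basis.\<close>

lemma dim_Union_lines_iff:
  assumes "finite L" "L \<subseteq> lines"
  shows "vec.dim (\<Union>L) = card L \<longleftrightarrow> vec.independent (generator ` L)"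
proof -
  have card: "card (generator ` L) = card L"
    using assms(2) inj_on_generator by (meson card_image inj_on_subset)
  have dim: "vec.dim (\<Union>L) = vec.dim (generator ` L)"
    using assms(2) span_Union_lines vec.dim_span by metis
  show ?thesis
  proof
    assume "vec.dim (\<Union>L) = card L"
    then show "vec.independent (generator ` L)"
      \<comment> \<open>The set of generators spans itself and has no more elements than its
        dimension, which forces independence.\<close>
      using vec.card_le_dim_spanning[of "generator ` L" "generator ` L"] assms(1) card dim
      by (simp add: vec.span_superset)
  next
    assume "vec.independent (generator ` L)"
    then show "vec.dim (\<Union>L) = card L"
      using card dim vec.dim_eq_card_independent by metis
  qed
qed

lemma matroid_K_complex:
  "matroid (K_complex :: ('a::{field,finite} ^ 'n::finite) set scomplex)"
proof (rule matroid_inv_image[OF matroid_X_complex])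
  show "inj_on generator (vertices (K_complex :: ('a ^ 'n) set scomplex))"
    by (simp add: K_complex_def inj_on_generator)
  show "generator ` vertices (K_complex :: ('a ^ 'n) set scomplex) \<subseteq> vertices X_complex"
    by (auto simp: K_complex_def X_complex_def generator_nonzero)
  show "simplices (K_complex :: ('a ^ 'n) set scomplex) =
      {L. L \<subseteq> vertices K_complex \<and> generator ` L \<in> simplices X_complex}"
    \<comment> \<open>Finiteness of \<open>L\<close> is automatic, since there are only finitely
      many sets of vectors.\<close>
    by (auto simp: K_complex_def X_complex_def dim_Union_lines_iff)
qed

theorem proposition2p12:
  shows "matroid (X_complex :: ('p::prime_card mod_ring ^ 'n::finite) scomplex) \<and>
         matroid (K_complex :: ('p mod_ring ^ 'n) set scomplex)"
  \<comment> \<open>For \<open>'p::prime_card\<close> the type \<open>'p mod_ring\<close> is a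
    finite field, so both results specialise. Types are nonempty, which gives n \<ge> 1.\<close>
  by (intro conjI matroid_X_complex matroid_K_complex)

end
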